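(* Let $\Gamma$ be a confusion graph on a finite source alphabet $\mathcal{X}$. There is a positive integer $b$ and a $b$-fold coloring $\mathcal{P}=\{T_1,\dots,T_m\}$ of $\Gamma$ with $\chi_f(\Gamma)=m/b$. For such a coloring, take sequence length $t=1$, code alphabet $\mathcal{Y}=\mathcal{P}$ (repeated elements of the multiset being regarded as distinct codewords), and $$P_{Y|X}(y|x)=\begin{cases}1/b,& x\in y,\\ 0,&\text{otherwise.}\end{cases}$$ Then $P_{Y|X}$ is a valid mapping scheme and $$L^1(P_{Y|X})=\log\chi_f(\Gamma),$$ so that this mapping achieves the maximal leakage rate, i.e. $L^1(P_{Y|X})=\mathcal{L}$.
   Context: Graphs are finite, simple and undirected. The confusion graph $\Gamma$ has vertex set $\mathcal{X}$, the finite alphabet of a discrete memoryless stationary source. For a positive integer $t$, $\Gamma_t=\Gamma^{\lor t}$ is the graph on $\mathcal{X}^t$ in which $x^t$ and $v^t$ are adjacent iff $\{x_j,v_j\}$ is an edge of $\Gamma$ for some $j\in\{1,\dots,t\}$; in particular $\Gamma_1=\Gamma$. A mapping scheme is a conditional distribution $P_{Y|X^t}$ from $\mathcal{X}^t$ to a finite code alphabet $\mathcal{Y}$ (which may be chosen freely). It is valid if for every $y\in\mathcal{Y}$ the set $\{x^t\in\mathcal{X}^t: P_{Y|X^t}(y|x^t)>0\}$ is an independent set of $\Gamma_t$. The maximal leakage of a valid mapping is $$L^t(P_{Y|X^t})=\log\max_{P_X}\frac{\sum_{y\in\mathcal{Y}}\max_{x^t\in\mathcal{X}^t}P_{X^t}(x^t)P_{Y|X^t}(y|x^t)}{\max_{x^t\in\mathcal{X}^t}P_{X^t}(x^t)}=\log\sum_{y\in\mathcal{Y}}\max_{x^t\in\mathcal{X}^t}P_{Y|X^t}(y|x^t),$$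 where the maximum is over all distributions $P_X$ on $\mathcal{X}$ and $P_{X^t}(x^t)=\prod_j P_X(x_j)$. Put $\mathcal{L}^t=\inf L^t(P_{Y|X^t})$ over all valid mappings, and $\mathcal{L}=\lim_{t\to\infty}\frac1t\mathcal{L}^t$ (the maximal leakage rate). A $b$-fold coloring of a graph $G$ is a multiset $\{T_1,\dots,T_m\}$ of independent sets of $G$ such that every vertex of $G$ is in exactly $b$ of them (counted with multiplicity). $\chi_b(G)$ is the least such $m$, and $\chi_f(G)=\inf_b\chi_b(G)/b$. The logarithm has a fixed base greater than 1. *)

theory Defs
  imports "HOL-Probability.Probability" "HOL-Library.Multiset"
begin

datatype 'a ugraph = Graph (verts: "'a set") (edges: "'a set set")

definition simple_graph :: "'a ugraph \<Rightarrow> bool" where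
  "simple_graph G \<longleftrightarrow> finite (verts G) \<and> (\<forall>e\<in>edges G. e \<subseteq> verts G \<and> card e = 2)"

definition independent_set :: "'a ugraph \<Rightarrow> 'a set \<Rightarrow> bool" where
  "independent_set G T \<longleftrightarrow> T \<subseteq> verts G \<and> (\<forall>u\<in>T. \<forall>v\<in>T. {u, v} \<notin> edges G)"

definition seqs :: "'a set \<Rightarrow> nat \<Rightarrow> 'a list set" where
  "seqs X t = {xs. length xs = t \<and> set xs \<subseteq> X}"

(* Positions are counted from 0, so j < t plays the role of j in {1..t}.  The graph
   or_power G 1 lives on one-element lists: it is G with x identified with [x]. *)
definition or_power :: "'a ugraph \<Rightarrow> nat \<Rightarrow> 'a list ugraph" where
  "or_power G t = Graph (seqs (verts G) t)
     {{xs, vs} | xs vs. xs \<in> seqs (verts G) t \<and> vs \<in> seqs (verts G) t \<and>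
                        (\<exists>j<t. {xs ! j, vs ! j} \<in> edges G)}"

definition fold_coloring :: "'a ugraph \<Rightarrow> nat \<Rightarrow> 'a set multiset \<Rightarrow> bool" where
  "fold_coloring G b P \<longleftrightarrow>
     (\<forall>T\<in>#P. independent_set G T) \<and> (\<forall>v\<in>verts G. size {#T \<in># P. v \<in> T#} = b)"

definition fold_chromatic_number :: "'a ugraph \<Rightarrow> nat \<Rightarrow> nat" where
  "fold_chromatic_number G b = (LEAST m. \<exists>P. fold_coloring G b P \<and> size P = m)"

definition fractional_chromatic_number :: "'a ugraph \<Rightarrow> real" where
  "fractional_chromatic_number G = (INF b\<in>{1..}. real (fold_chromatic_number G b) / real b)"

(* W xs y is the conditional probability of y given xs; only its values for
   xs in X^t and y in Y matter. *)
definition mapping_scheme :: "'a ugraph \<Rightarrow> nat \<Rightarrow> 'y set \<Rightarrow> ('a list \<Rightarrow> 'y \<Rightarrow> real) \<Rightarrow> bool" where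
  "mapping_scheme G t Y W \<longleftrightarrow> finite Y \<and>
     (\<forall>xs\<in>verts (or_power G t). (\<forall>y\<in>Y. W xs y \<ge> 0) \<and> (\<Sum>y\<in>Y. W xs y) = 1)"

definition valid_mapping :: "'a ugraph \<Rightarrow> nat \<Rightarrow> 'y set \<Rightarrow> ('a list \<Rightarrow> 'y \<Rightarrow> real) \<Rightarrow> bool" where
  "valid_mapping G t Y W \<longleftrightarrow> mapping_scheme G t Y W \<and>
     (\<forall>y\<in>Y. independent_set (or_power G t) {xs \<in> verts (or_power G t). W xs y > 0})"

definition seq_prob :: "'a pmf \<Rightarrow> 'a list \<Rightarrow> real" where
  "seq_prob p xs = (\<Prod>j<length xs. pmf p (xs ! j))"

(* The supremum over source distributions is attained, see max_leakage_eq below. *)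
definition max_leakage ::
    "real \<Rightarrow> 'a ugraph \<Rightarrow> nat \<Rightarrow> 'y set \<Rightarrow> ('a list \<Rightarrow> 'y \<Rightarrow> real) \<Rightarrow> real" where
  "max_leakage c G t Y W = log c
     (SUP p\<in>{p. set_pmf p \<subseteq> verts G}.
        (\<Sum>y\<in>Y. MAX xs\<in>verts (or_power G t). seq_prob p xs * W xs y) /
        (MAX xs\<in>verts (or_power G t). seq_prob p xs))"

(* Finite code alphabets are taken inside nat: up to renaming of codewords,
   which does not affect validity or leakage, this covers every finite alphabet. *)
definition optimal_leakage :: "real \<Rightarrow> 'a ugraph \<Rightarrow> nat \<Rightarrow> real" where
  "optimal_leakage c G t =
     Inf {max_leakage c G t Y W | (Y :: nat set) W. valid_mapping G t Y W}"

definition max_leakage_rate :: "real \<Rightarrow> 'a ugraph \<Rightarrow> real" where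
  "max_leakage_rate c G = lim (\<lambda>t. optimal_leakage c G t / real t)"

(* An element T of multiplicity k yields the k distinct codewords (T,0), ..., (T,k-1). *)
definition codewords :: "'a multiset \<Rightarrow> ('a \<times> nat) set" where
  "codewords P = {(T, i). i < count P T}"

definition coloring_mapping :: "nat \<Rightarrow> 'a list \<Rightarrow> 'a set \<times> nat \<Rightarrow> real" where
  "coloring_mapping b xs y = (if xs ! 0 \<in> fst y then 1 / real b else 0)"

lemma finite_seqs: "finite X \<Longrightarrow> finite (seqs X t)"
  unfolding seqs_def using finite_lists_length_eq[of X t] by (simp add: conj_commute)

lemma seqs_nonempty: "X \<noteq> {} \<Longrightarrow> seqs X t \<noteq> {}"
proof -
  assume "X \<noteq> {}"
  then obtain x where "x \<in> X" by blast
  then have "replicate t x \<in> seqs X t" by (auto simp: seqs_def)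
  then show ?thesis by blast
qed

lemma max_leakage_eq:
  fixes W :: "'a list \<Rightarrow> 'y \<Rightarrow> real"
  assumes G: "simple_graph G" "verts G \<noteq> {}" and W: "mapping_scheme G t Y W"
  defines "R \<equiv> (\<lambda>p. (\<Sum>y\<in>Y. MAX xs\<in>verts (or_power G t). seq_prob p xs * W xs y) /
        (MAX xs\<in>verts (or_power G t). seq_prob p xs))"
    and "S \<equiv> (\<Sum>y\<in>Y. MAX xs\<in>verts (or_power G t). W xs y)"
  shows "max_leakage c G t Y W = log c S"
    and "\<exists>p. set_pmf p \<subseteq> verts G \<and> R p = S"
    and "set_pmf p \<subseteq> verts G \<Longrightarrow> R p \<le> S"
proof -
  define A where "A = verts (or_power G t)"
  have A: "finite A" "A \<noteq> {}" and As: "A = seqs (verts G) t"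
    using G by (auto simp: A_def or_power_def simple_graph_def finite_seqs seqs_nonempty)
  have fin: "finite (verts G)" using G by (simp add: simple_graph_def)
  have Wnn: "W xs y \<ge> 0" if "xs \<in> A" "y \<in> Y" for xs y
    using W that by (auto simp: mapping_scheme_def A_def)
  have seq_nn: "seq_prob p xs \<ge> 0" for p :: "'a pmf" and xs
    by (auto simp: seq_prob_def intro!: prod_nonneg)
  show bound: "R p \<le> S" if p: "set_pmf p \<subseteq> verts G" for p
  proof -
    obtain x where x: "x \<in> set_pmf p" using set_pmf_not_empty by fast
    have "replicate t x \<in> A" using x p by (auto simp: As seqs_def)
    moreover have "seq_prob p (replicate t x) > 0"
      using x by (auto simp: seq_prob_def pmf_positive intro!: prod_pos)
    ultimately have pos: "Max (seq_prob p ` A) > 0"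
      using A by (subst Max_gr_iff) auto
    have "(MAX xs\<in>A. seq_prob p xs * W xs y) \<le> Max (seq_prob p ` A) * (MAX xs\<in>A. W xs y)"
      if "y \<in> Y" for y
    proof -
      have "seq_prob p xs * W xs y \<le> Max (seq_prob p ` A) * (MAX xs\<in>A. W xs y)"
        if "xs \<in> A" for xs
        using A Wnn[OF that \<open>y \<in> Y\<close>] that
        by (intro mult_mono Max_ge less_imp_le[OF pos] finite_imageI imageI)
      then show ?thesis using A by simp
    qed
    then have "(\<Sum>y\<in>Y. MAX xs\<in>A. seq_prob p xs * W xs y) \<le> Max (seq_prob p ` A) * S"
      unfolding S_def A_def[symmetric] sum_distrib_left by (rule sum_mono)
    then show ?thesis using pos
      unfolding R_def A_def[symmetric] by (simp add: divide_le_eq mult.commute)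
  qed
  show attained: "\<exists>p. set_pmf p \<subseteq> verts G \<and> R p = S"
  proof (intro exI conjI)
    let ?p = "pmf_of_set (verts G)" and ?k = "(1 / real (card (verts G))) ^ t"
    show "set_pmf ?p \<subseteq> verts G" using fin G by simp
    have k: "?k > 0" using fin G by (simp add: card_gt_0_iff)
    have sp: "seq_prob ?p xs = ?k" if "xs \<in> A" for xs
    proof -
      have "xs ! j \<in> verts G" if "j < t" for j
        using that \<open>xs \<in> A\<close> nth_mem[of j xs] by (auto simp: As seqs_def simp del: nth_mem)
      then show ?thesis using \<open>xs \<in> A\<close> fin G
        by (simp add: seq_prob_def As seqs_def)
    qed
    have "(MAX xs\<in>A. seq_prob ?p xs * W xs y) = ?k * (MAX xs\<in>A. W xs y)" for y
    proof -
      have "(MAX xs\<in>A. seq_prob ?p xs * W xs y) = Max ((\<lambda>z. ?k * z) ` (\<lambda>xs. W xs y) ` A)"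
        unfolding image_image by (intro arg_cong[where f = Max] image_cong refl) (simp add: sp)
      also have "\<dots> = ?k * (MAX xs\<in>A. W xs y)"
        using A k by (intro mono_Max_commute[symmetric] monoI mult_left_mono) auto
      finally show ?thesis .
    qed
    moreover have "Max (seq_prob ?p ` A) = ?k"
    proof -
      have "seq_prob ?p ` A = {?k}" using A sp by auto
      then show ?thesis by simp
    qed
    ultimately show "R ?p = S"
      using less_imp_neq[OF k] unfolding R_def S_def A_def[symmetric]
      by (simp only: sum_distrib_left[symmetric] nonzero_mult_div_cancel_left not_sym)
  qed
  from attained bound have "(SUP p\<in>{p. set_pmf p \<subseteq> verts G}. R p) = S"
    by (intro cSup_eq_maximum) auto
  then show "max_leakage c G t Y W = log c S"
    by (simp add: max_leakage_def R_def)
qed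

end

theory Submission imports Defs "HOL-Library.Ramsey" begin

text \<open>
  The infimum over \<open>b\<close> is attained because the colorings form a monoid of multisets closed under
  differences of comparable elements, so every coloring decomposes into minimal ones; by Dickson's
  lemma there are finitely many minimal colorings, and the best ratio is reached at one of them.

  Every valid mapping for length \<open>t\<close> gives a weighted covering of the sequences by boxes whose sides
  are independent sets of the graph, since the coordinate projections of an independent set of the
  power are independent. Peeling off one coordinate at a time shows that such a covering has total
  weight at least the \<open>t\<close>-th power of the fractional chromatic number; this replaces LP duality.
  Product mappings attain the bound, so the normalised optimal leakage does not depend on \<open>t\<close>.
\<close>

section \<open>Fold colorings\<close>

abbreviation coverage :: "'a set multiset \<Rightarrow> 'a \<Rightarrow> nat" where
  "coverage P v \<equiv> size {#T \<in># P. v \<in> T#}"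

lemma coverage_replicate_mset: "coverage (replicate_mset n T) v = (if v \<in> T then n else 0)"
  by (induction n) auto

lemma independent_set_mono: "independent_set G T \<Longrightarrow> S \<subseteq> T \<Longrightarrow> independent_set G S"
  by (auto simp: independent_set_def)

lemma independent_set_singleton:
  assumes "simple_graph G" "v \<in> verts G"
  shows "independent_set G {v}"
proof -
  have "{v, v} \<notin> edges G"
    using assms unfolding simple_graph_def by (metis card_1_singleton_iff insert_absorb2
        numeral_eq_one_iff semiring_norm(85) One_nat_def)
  then show ?thesis using assms by (auto simp: independent_set_def)
qed

text \<open>Coverage is additive over \<open>P = Q + (P - Q)\<close>, so a coloring contained in
  another leaves a coloring behind. This makes the splitting into minimal colorings
  possible.\<close>

lemma fold_coloring_diff:
  assumes "fold_coloring G b P" "fold_coloring G b' Q" "Q \<subseteq># P"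
  shows "fold_coloring G (b - b') (P - Q)"
  unfolding fold_coloring_def
proof (intro conjI ballI)
  show "independent_set G T" if "T \<in># P - Q" for T
    using assms(1) in_diffD[OF that] by (auto simp: fold_coloring_def)
  show "coverage (P - Q) v = b - b'" if "v \<in> verts G" for v
  proof -
    have "coverage (P - Q) v = coverage P v - coverage Q v"
      using assms(3) by (simp add: filter_diff_mset size_Diff_submset multiset_filter_mono)
    then show ?thesis using assms(1,2) that by (simp add: fold_coloring_def)
  qed
qed

text \<open>Each new member loses the vertices that are already covered \<open>b\<close> times. A
  member that becomes empty is kept, so the size does not change.\<close>

lemma trim_coverage:
  "\<exists>Q. size Q = size P \<and> (\<forall>S\<in>#Q. \<exists>T\<in>#P. S \<subseteq> T) \<and> (\<forall>v. coverage Q v = min b (coverage P v))"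
proof (induction P)
  case empty
  then show ?case by auto
next
  case (add T P)
  then obtain Q where Q: "size Q = size P" "\<forall>S\<in>#Q. \<exists>T\<in>#P. S \<subseteq> T"
    "\<And>v. coverage Q v = min b (coverage P v)" by blast
  let ?Q = "add_mset {v\<in>T. coverage Q v < b} Q"
  have "coverage ?Q v = min b (coverage (add_mset T P) v)" for v
    using Q(3)[of v] by auto
  then show ?case using Q(1,2) by (intro exI[of _ ?Q]) auto
qed

text \<open>Excess coverage can be trimmed because subsets of independent sets are independent.
  Later constructions therefore only need a lower bound on coverage.\<close>

lemma fold_coloring_of_cover:
  assumes "\<forall>T\<in>#P. independent_set G T" "\<forall>v\<in>verts G. coverage P v \<ge> b"
  shows "\<exists>Q. fold_coloring G b Q \<and> size Q = size P"
proof -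
  obtain Q where Q: "size Q = size P" "\<forall>S\<in>#Q. \<exists>T\<in>#P. S \<subseteq> T"
    "\<And>v. coverage Q v = min b (coverage P v)" using trim_coverage[of P b] by blast
  have "fold_coloring G b Q"
    unfolding fold_coloring_def
  proof (intro conjI ballI)
    show "independent_set G S" if "S \<in># Q" for S
      using Q(2) assms(1) that independent_set_mono by blast
    show "coverage Q v = b" if "v \<in> verts G" for v
      using Q(3)[of v] assms(2) that by simp
  qed
  then show ?thesis using Q(1) by blast
qed

lemma fold_chromatic_number_le: "fold_coloring G b P \<Longrightarrow> fold_chromatic_number G b \<le> size P"
  unfolding fold_chromatic_number_def by (rule Least_le) blast

text \<open>Some coloring must exist for the \<open>LEAST\<close> in
  \<open>fold_chromatic_number\<close> to be attained.\<close>

lemma ex_fold_coloring: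
  assumes "simple_graph G"
  shows "\<exists>P. fold_coloring G b P \<and> size P = fold_chromatic_number G b"
proof -
  have fin: "finite (verts G)" using assms by (simp add: simple_graph_def)
  \<comment> \<open>Every singleton taken \<open>b\<close> times; singletons are independent since
    there are no loops.\<close>
  define P where "P = (\<Sum>v\<in>verts G. replicate_mset b {v})"
  have "P' \<in> (\<lambda>v. {v}) ` verts G" if "P' \<in># P" for P'
    using that fin by (auto simp: P_def set_mset_sum)
  then have "\<forall>T\<in>#P. independent_set G T"
    using assms independent_set_singleton by fastforce
  moreover have "b \<le> coverage P v" if "v \<in> verts G" for v
  proof -
    have "coverage (replicate_mset b {v}) v \<le> coverage P v"
      unfolding P_def using fin that
      by (intro size_mset_mono multiset_filter_mono) (simp add: sum.remove)
    then show ?thesis by (simp add: coverage_replicate_mset)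
  qed
  ultimately obtain Q where "fold_coloring G b Q"
    using fold_coloring_of_cover by blast
  then show ?thesis
    unfolding fold_chromatic_number_def
    by (intro LeastI_ex[of "\<lambda>m. \<exists>P. fold_coloring G b P \<and> size P = m"]) blast
qed

lemma fractional_chromatic_number_le:
  assumes "fold_coloring G b P" "b > 0"
  shows "fractional_chromatic_number G \<le> real (size P) / real b"
proof -
  have "fractional_chromatic_number G \<le> real (fold_chromatic_number G b) / real b"
    unfolding fractional_chromatic_number_def using assms(2)
    by (intro cINF_lower bdd_belowI2[where m = 0]) auto
  also have "\<dots> \<le> real (size P) / real b"
    using fold_chromatic_number_le[OF assms(1)] by (simp add: divide_right_mono)
  finally show ?thesis .
qed

lemma fractional_chromatic_number_ge:
  assumes "simple_graph G"
    and "\<And>b P. b > 0 \<Longrightarrow> fold_coloring G b P \<Longrightarrow> r \<le> real (size P) / real b"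
  shows "r \<le> fractional_chromatic_number G"
  unfolding fractional_chromatic_number_def
proof (rule cINF_greatest)
  fix b :: nat assume "b \<in> {1..}"
  moreover obtain P where "fold_coloring G b P" "size P = fold_chromatic_number G b"
    using ex_fold_coloring[OF assms(1)] by blast
  ultimately show "r \<le> real (fold_chromatic_number G b) / real b"
    using assms(2)[of b P] by simp
qed simp

text \<open>A single vertex already lies in \<open>b\<close> members. Later divisions and logarithms
  need the resulting positivity.\<close>

lemma fractional_chromatic_number_ge_1:
  assumes "simple_graph G" "verts G \<noteq> {}"
  shows "fractional_chromatic_number G \<ge> 1"
proof (rule fractional_chromatic_number_ge[OF assms(1)])
  fix b :: nat and P :: "'a set multiset"
  assume b: "b > 0" "fold_coloring G b P"
  obtain v where "v \<in> verts G" using assms(2) by blast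
  then have "b \<le> size P"
    using b(2) size_filter_mset_lesseq by (metis fold_coloring_def)
  then show "1 \<le> real (size P) / real b" using b(1) by simp
qed

section \<open>Attainment of the infimum\<close>

text \<open>Dickson's lemma, by Ramsey's theorem: if no two members were comparable, some coordinate
  would decrease along an infinite subsequence.\<close>

lemma finite_antichain_mset:
  fixes M :: "'b multiset set"
  assumes fin: "finite A" and sub: "\<And>P. P \<in> M \<Longrightarrow> set_mset P \<subseteq> A"
    and anti: "\<And>P Q. P \<in> M \<Longrightarrow> Q \<in> M \<Longrightarrow> \<not> P \<subset># Q"
  shows "finite M"
proof (rule ccontr)
  assume "infinite M"
  then obtain g :: "nat \<Rightarrow> 'b multiset" where g: "inj g" "range g \<subseteq> M"
    using infinite_countable_subset by blast
  obtain n u where u: "A = u ` {i::nat. i < n}"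
    using finite_imp_nat_seg_image_inj_on[OF fin] by blast
  have ex: "\<exists>k<n. count (g i) (u k) > count (g j) (u k)" if "i \<noteq> j" for i j
  proof (rule ccontr)
    assume *: "\<not> ?thesis"
    have "count (g i) T \<le> count (g j) T" for T
    proof (cases "T \<in> A")
      case True
      then obtain k where "T = u k" "k < n" using u by auto
      then show ?thesis using * by (meson not_less)
    next
      case False
      then show ?thesis using sub g(2) by (metis count_eq_zero_iff le0 range_subsetD subsetD)
    qed
    then have "g i \<subseteq># g j" by (simp add: mset_subset_eqI)
    moreover have "g i \<noteq> g j" using g(1) that by (auto dest: injD)
    ultimately show False using anti g(2) by (meson range_subsetD subset_mset.le_imp_less_or_eq)
  qed
  \<comment> \<open>Color the pair \<open>{i, j}\<close> with \<open>i < j\<close> by a coordinate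
    in which \<open>g i\<close> has strictly larger multiplicity than \<open>g j\<close>;
    \<open>Min\<close> and \<open>Max\<close> recover the order from the unordered pair.\<close>
  define f where
    "f X = (SOME k. k < n \<and> count (g (Min X)) (u k) > count (g (Max X)) (u k))" for X :: "nat set"
  have f: "f {i, j} < n \<and> count (g i) (u (f {i, j})) > count (g j) (u (f {i, j}))" if "i < j" for i j
  proof -
    have "Min {i, j} = i" "Max {i, j} = j" using that by auto
    then show ?thesis
      unfolding f_def using ex[of i j] that by (smt (verit, best) someI_ex less_irrefl)
  qed
  have "f {i, j} < n" if "i \<noteq> j" for i j
    using f[of i j] f[of j i] that by (metis insert_commute nat_neq_iff)
  then obtain Y k where Y: "infinite Y" "\<forall>x\<in>Y. \<forall>y\<in>Y. x \<noteq> y \<longrightarrow> f {x, y} = k"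
    using Ramsey2[of "UNIV :: nat set" f n] by (metis infinite_UNIV_nat)
  \<comment> \<open>All pairs from the infinite set \<open>Y\<close> have color \<open>k\<close>, so
    the multiplicity of \<open>u k\<close> falls at each step along \<open>Y\<close>, contradicting
    well-foundedness of the naturals.\<close>
  have "count (g (enumerate Y (Suc i))) (u k) < count (g (enumerate Y i)) (u k)" for i
  proof -
    have "enumerate Y i < enumerate Y (Suc i)" "enumerate Y i \<in> Y" "enumerate Y (Suc i) \<in> Y"
      using Y(1) by (simp_all add: enumerate_step enumerate_in_set del: enumerate_Suc)
    then show ?thesis using f Y(2) by (metis less_irrefl)
  qed
  then have "\<exists>c :: nat \<Rightarrow> nat. \<forall>i. (c (Suc i), c i) \<in> less_than"
    by (intro exI[of _ "\<lambda>i. count (g (enumerate Y i)) (u k)"]) simp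
  then show False
    using wf_less_than unfolding wf_iff_no_infinite_down_chain by blast
qed

text \<open>Minimality is with respect to inclusion and ranges over every positive multiplicity
  \<open>b'\<close>, not just \<open>b\<close>; this makes minimal colorings an antichain.\<close>

definition minimal_coloring :: "'a ugraph \<Rightarrow> nat \<Rightarrow> 'a set multiset \<Rightarrow> bool" where
  "minimal_coloring G b P \<longleftrightarrow>
     b > 0 \<and> fold_coloring G b P \<and> (\<forall>Q b'. Q \<subset># P \<longrightarrow> b' > 0 \<longrightarrow> \<not> fold_coloring G b' Q)"

lemma finite_minimal_colorings:
  assumes "simple_graph G"
  shows "finite {P. \<exists>b. minimal_coloring G b P}"
proof (rule finite_antichain_mset)
  show "finite (Pow (verts G))" using assms by (simp add: simple_graph_def)
  show "set_mset P \<subseteq> Pow (verts G)" if "P \<in> {P. \<exists>b. minimal_coloring G b P}" for P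
    using that by (auto simp: minimal_coloring_def fold_coloring_def independent_set_def)
qed (auto simp: minimal_coloring_def)

text \<open>Induction on the size. If \<open>P\<close> contains a smaller coloring \<open>Q\<close>,
  the ratio of \<open>P\<close> is the mediant of those of \<open>Q\<close> and
  \<open>P - Q\<close>, so one of the two has a ratio no larger than that of
  \<open>P\<close>.\<close>

lemma ex_minimal_coloring_ratio_le:
  assumes V: "verts G \<noteq> {}" and "b > 0" "fold_coloring G b P"
  shows "\<exists>b' Q. minimal_coloring G b' Q \<and> real (size Q) / real b' \<le> real (size P) / real b"
  using assms(2,3)
proof (induction "size P" arbitrary: P b rule: less_induct)
  case less
  show ?case
  proof (cases "minimal_coloring G b P")
    case True
    then show ?thesis by blast
  next
    case False
    then obtain Q b' where Q: "Q \<subset># P" "b' > 0" "fold_coloring G b' Q"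
      using less.prems by (auto simp: minimal_coloring_def)
    obtain v where v: "v \<in> verts G" using V by blast
    have sub: "Q \<subseteq># P" using Q(1) by (simp add: subset_mset.less_imp_le)
    have R: "fold_coloring G (b - b') (P - Q)" by (rule fold_coloring_diff) fact+
    have bb: "b' \<le> b"
      using less.prems(2) Q(3) v size_mset_mono[OF multiset_filter_mono[OF sub]]
      by (metis fold_coloring_def)
    have sz: "size (P - Q) = size P - size Q" "size Q \<le> size P" "size Q < size P"
      using sub Q(1) by (auto simp: size_Diff_submset size_mset_mono mset_subset_size)
    have "Q \<noteq> {#}" using Q(2,3) v by (auto simp: fold_coloring_def)
    then have Q0: "size Q > 0" by (simp add: nonempty_has_size)
    have b0: "real b > 0" "real b' > 0" using less.prems(1) Q(2) by auto
    show ?thesis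
    proof (cases "real (size Q) / real b' \<le> real (size P) / real b")
      case True
      then show ?thesis using less.hyps[OF sz(3) Q(2,3)] by (meson order_trans)
    next
      case F: False
      then have lt: "real (size P) * real b' < real (size Q) * real b"
        using b0 by (simp add: field_simps)
      \<comment> \<open>With equal multiplicities the smaller \<open>Q\<close> would have the
        smaller ratio. Hence the remainder has positive multiplicity and its ratio makes
        sense.\<close>
      have "b' \<noteq> b"
      proof
        assume "b' = b"
        then show False using lt sz(2) b0 by simp
      qed
      then have bp: "b - b' > 0" using bb by simp
      have "real (size (P - Q)) / real (b - b') \<le> real (size P) / real b"
        using lt bp b0 bb sz by (simp add: of_nat_diff divide_le_eq pos_le_divide_eq field_simps)
      moreover have "size (P - Q) < size P" using sz Q0 by simp
      ultimately show ?thesis using less.hyps[OF _ bp R] by (meson order_trans)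
    qed
  qed
qed

lemma fractional_chromatic_number_attained:
  assumes "simple_graph G" "verts G \<noteq> {}"
  shows "\<exists>b P. b > 0 \<and> fold_coloring G b P \<and>
           fractional_chromatic_number G = real (size P) / real b"
proof -
  \<comment> \<open>The multiplicity is read off as the coverage of one fixed vertex, so that the
    ratio depends on the multiset alone and can be minimised over the finite set
    \<open>?M\<close>.\<close>
  define ratio where "ratio P = real (size P) / real (coverage P (SOME v. v \<in> verts G))"
    for P :: "'a set multiset"
  have ratio: "ratio P = real (size P) / real b" if "fold_coloring G b P" for b P
    using that someI_ex[of "\<lambda>v. v \<in> verts G"] assms(2)
    by (auto simp: ratio_def fold_coloring_def)
  let ?M = "{P. \<exists>b. minimal_coloring G b P}"
  obtain P0 where "fold_coloring G 1 P0" using ex_fold_coloring[OF assms(1)] by blast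
  then have "?M \<noteq> {}" using ex_minimal_coloring_ratio_le[OF assms(2), of 1 P0] by auto
  then obtain P where P: "P \<in> ?M" "\<And>Q. Q \<in> ?M \<Longrightarrow> ratio P \<le> ratio Q"
    using ex_is_arg_min_if_finite[OF finite_minimal_colorings[OF assms(1)], of ratio]
    by (auto simp: is_arg_min_def not_less)
  then obtain b where b: "b > 0" "fold_coloring G b P" by (auto simp: minimal_coloring_def)
  have "real (size P) / real b \<le> fractional_chromatic_number G"
  proof (rule fractional_chromatic_number_ge[OF assms(1)])
    fix b' :: nat and Q :: "'a set multiset"
    assume "b' > 0" "fold_coloring G b' Q"
    then obtain b'' R where R: "minimal_coloring G b'' R"
      "real (size R) / real b'' \<le> real (size Q) / real b'"
      using ex_minimal_coloring_ratio_le[OF assms(2)] by blast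
    then have "ratio P \<le> ratio R" using P(2) by blast
    then show "real (size P) / real b \<le> real (size Q) / real b'"
      using R ratio[OF b(2)] ratio[of b'' R] by (simp add: minimal_coloring_def)
  qed
  then show ?thesis using b fractional_chromatic_number_le[OF b(2,1)] by force
qed

section \<open>Weighted coverings\<close>

text \<open>Real weights are rounded up to multiples of \<open>1 / N\<close>, which costs at most \<open>card Y / N\<close>.\<close>

lemma fractional_chromatic_number_le_cover:
  fixes w :: "'y \<Rightarrow> real"
  assumes Y: "finite Y" and w: "\<And>y. y \<in> Y \<Longrightarrow> w y \<ge> 0"
    and ind: "\<And>y. y \<in> Y \<Longrightarrow> independent_set G (A y)"
    and cov: "\<And>v. v \<in> verts G \<Longrightarrow> (\<Sum>y\<in>{y\<in>Y. v \<in> A y}. w y) \<ge> 1"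
  shows "fractional_chromatic_number G \<le> sum w Y"
proof -
  have bound: "fractional_chromatic_number G \<le> sum w Y + real (card Y) / real N"
    if N: "N > 0" for N :: nat
  proof -
    define n where "n y = nat \<lceil>real N * w y\<rceil>" for y
    have n: "real N * w y \<le> real (n y)" "real (n y) \<le> real N * w y + 1" if "y \<in> Y" for y
      using w[OF that] by (simp_all add: n_def of_nat_ceiling of_int_ceiling_le_add_one)
    define P where "P = (\<Sum>y\<in>Y. replicate_mset (n y) (A y))"
    have "\<forall>T\<in>#P. independent_set G T"
      using ind Y by (auto simp: P_def set_mset_sum split: if_splits)
    moreover have "N \<le> coverage P v" if "v \<in> verts G" for v
    proof -
      have "coverage P v = (\<Sum>y\<in>Y. if v \<in> A y then n y else 0)"
        unfolding P_def using Y
        by (induction Y rule: finite_induct) (simp_all add: coverage_replicate_mset)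
      also have "\<dots> = (\<Sum>y\<in>{y\<in>Y. v \<in> A y}. n y)"
        using Y by (simp add: sum.inter_filter)
      finally have "real (coverage P v) = (\<Sum>y\<in>{y\<in>Y. v \<in> A y}. real (n y))" by simp
      also have "\<dots> \<ge> (\<Sum>y\<in>{y\<in>Y. v \<in> A y}. real N * w y)"
        using n by (intro sum_mono) auto
      also have "(\<Sum>y\<in>{y\<in>Y. v \<in> A y}. real N * w y) \<ge> real N"
        using cov[OF that] N by (simp flip: sum_distrib_left)
      finally show ?thesis by simp
    qed
    ultimately obtain Q where Q: "fold_coloring G N Q" "size Q = size P"
      using fold_coloring_of_cover by blast
    have "size P = (\<Sum>y\<in>Y. n y)"
      unfolding P_def using Y by (induction Y rule: finite_induct) auto
    then have "real (size Q) \<le> (\<Sum>y\<in>Y. real N * w y + 1)"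
      unfolding Q(2) using n(2) by (simp add: sum_mono del: sum.distrib)
    also have "\<dots> = real N * sum w Y + real (card Y)"
      by (simp add: sum.distrib sum_distrib_left)
    finally have "real (size Q) / real N \<le> sum w Y + real (card Y) / real N"
      using N by (simp add: field_simps)
    then show ?thesis using fractional_chromatic_number_le[OF Q(1) N] by linarith
  qed
  \<comment> \<open>The rounding cost vanishes as \<open>N\<close> grows; the bound is used from
    \<open>N = 1\<close> on.\<close>
  have "(\<lambda>N. sum w Y + real (card Y) / real N) \<longlonglongrightarrow> sum w Y + 0"
    by (intro tendsto_intros lim_const_over_n)
  then show ?thesis
    using bound by (intro LIMSEQ_le_const[where X = "\<lambda>N. sum w Y + real (card Y) / real N"])
      (auto intro!: exI[of _ 1])
qed

text \<open>Dividing all weights by \<open>r\<close> reduces to covering multiplicity one.\<close>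

lemma cover_weight_ge:
  fixes w :: "'y \<Rightarrow> real"
  assumes Y: "finite Y" and w: "\<And>y. y \<in> Y \<Longrightarrow> w y \<ge> 0"
    and ind: "\<And>y. y \<in> Y \<Longrightarrow> independent_set G (A y)"
    and r: "r > 0" and cov: "\<And>v. v \<in> verts G \<Longrightarrow> (\<Sum>y\<in>{y\<in>Y. v \<in> A y}. w y) \<ge> r"
  shows "r * fractional_chromatic_number G \<le> sum w Y"
proof -
  have "fractional_chromatic_number G \<le> (\<Sum>y\<in>Y. w y / r)"
    using Y w ind cov r
    by (intro fractional_chromatic_number_le_cover[where A = A])
      (auto simp flip: sum_divide_distrib)
  then show ?thesis using r by (simp add: field_simps flip: sum_divide_distrib)
qed

text \<open>The boxes containing a fixed first coordinate already cover all tails, so their weight is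
  at least the bound for \<open>t\<close>; hence the first sides form a covering with that multiplicity.\<close>

lemma box_cover_weight_ge:
  fixes w :: "'y \<Rightarrow> real"
  assumes G: "simple_graph G" "verts G \<noteq> {}"
    and Y: "finite Y" and w: "\<And>y. y \<in> Y \<Longrightarrow> w y \<ge> 0"
    and ind: "\<And>y j. y \<in> Y \<Longrightarrow> j < t \<Longrightarrow> independent_set G (A y j)"
    and cov: "\<And>xs. xs \<in> seqs (verts G) t \<Longrightarrow> (\<Sum>y\<in>{y\<in>Y. \<forall>j<t. xs ! j \<in> A y j}. w y) \<ge> 1"
  shows "fractional_chromatic_number G ^ t \<le> sum w Y"
  using Y w ind cov
proof (induction t arbitrary: Y A)
  case 0
  \<comment> \<open>The box condition is vacuous, so every member of \<open>Y\<close> covers the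
    empty sequence and the total weight is at least 1.\<close>
  from "0.prems"(4)[of "[]"] show ?case by (simp add: seqs_def)
next
  case (Suc t)
  have "fractional_chromatic_number G ^ t * fractional_chromatic_number G \<le> sum w Y"
  proof (rule cover_weight_ge[where A = "\<lambda>y. A y 0"])
    show "fractional_chromatic_number G ^ t > 0"
      using fractional_chromatic_number_ge_1[OF G] by simp
    fix v assume v: "v \<in> verts G"
    show "fractional_chromatic_number G ^ t \<le> (\<Sum>y\<in>{y\<in>Y. v \<in> A y 0}. w y)"
    proof (rule Suc.IH[where A = "\<lambda>y j. A y (Suc j)"])
      fix xs assume "xs \<in> seqs (verts G) t"
      then have "v # xs \<in> seqs (verts G) (Suc t)" using v by (simp add: seqs_def)
      from Suc.prems(4)[OF this] show
        "1 \<le> (\<Sum>y\<in>{y \<in> {y\<in>Y. v \<in> A y 0}. \<forall>j<t. xs ! j \<in> A y (Suc j)}. w y)"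
        by (simp add: All_less_Suc2 conj_ac)
    qed (use Suc.prems in auto)
  qed (use Suc.prems in auto)
  then show ?case by (simp add: mult.commute)
qed

section \<open>Leakage\<close>

lemma verts_or_power [simp]: "verts (or_power G t) = seqs (verts G) t"
  by (simp add: or_power_def)

text \<open>An edge between the entries at one position already makes two sequences adjacent. Hence
  the support of a codeword lies in a box with independent sides.\<close>

lemma independent_set_or_powerD:
  assumes "independent_set (or_power G t) S" "j < t"
  shows "independent_set G ((\<lambda>xs. xs ! j) ` S)"
proof -
  have S: "S \<subseteq> seqs (verts G) t" using assms(1) by (simp add: independent_set_def)
  have "xs ! j \<in> verts G" if "xs \<in> S" for xs
    using subsetD[OF S that] assms(2) nth_mem[of j xs] by (auto simp: seqs_def simp del: nth_mem)
  moreover have "{xs ! j, vs ! j} \<notin> edges G" if "xs \<in> S" "vs \<in> S" for xs vs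
  proof
    assume "{xs ! j, vs ! j} \<in> edges G"
    then have "{xs, vs} \<in> edges (or_power G t)"
      unfolding or_power_def ugraph.sel using that S assms(2) by blast
    then show False using assms(1) that by (auto simp: independent_set_def)
  qed
  ultimately show ?thesis unfolding independent_set_def by blast
qed

lemma independent_set_or_powerI:
  assumes "S \<subseteq> seqs (verts G) t"
    and "\<And>xs vs j. xs \<in> S \<Longrightarrow> vs \<in> S \<Longrightarrow> j < t \<Longrightarrow> {xs ! j, vs ! j} \<notin> edges G"
  shows "independent_set (or_power G t) S"
  unfolding independent_set_def verts_or_power
proof (intro conjI ballI notI)
  fix u v assume uv: "u \<in> S" "v \<in> S" "{u, v} \<in> edges (or_power G t)"
  then obtain xs vs j where "{u, v} = {xs, vs}" "j < t" "{xs ! j, vs ! j} \<in> edges G"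
    unfolding or_power_def ugraph.sel by blast
  moreover from this have "xs \<in> S" "vs \<in> S" using uv by auto
  ultimately show False using assms(2) by blast
qed (rule assms(1))

text \<open>Give each codeword its largest conditional probability as weight and the box spanned by
  the projections of its support; these boxes form a weighted covering.\<close>

lemma leakage_sum_ge:
  assumes G: "simple_graph G" "verts G \<noteq> {}" and W: "valid_mapping G t Y W"
  shows "fractional_chromatic_number G ^ t \<le> (\<Sum>y\<in>Y. MAX xs\<in>seqs (verts G) t. W xs y)"
proof -
  let ?X = "seqs (verts G) t"
  let ?S = "\<lambda>y. {xs\<in>?X. W xs y > 0}"
  have X: "finite ?X" "?X \<noteq> {}"
    using G by (auto simp: simple_graph_def finite_seqs seqs_nonempty)
  have Y: "finite Y" and W0: "\<And>xs y. xs \<in> ?X \<Longrightarrow> y \<in> Y \<Longrightarrow> W xs y \<ge> 0"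
    and W1: "\<And>xs. xs \<in> ?X \<Longrightarrow> (\<Sum>y\<in>Y. W xs y) = 1"
    and ind: "\<And>y. y \<in> Y \<Longrightarrow> independent_set (or_power G t) (?S y)"
    using W by (auto simp: valid_mapping_def mapping_scheme_def)
  have le: "W xs y \<le> (MAX xs\<in>?X. W xs y)" if "xs \<in> ?X" for xs y
    using X that by simp
  show ?thesis
  proof (rule box_cover_weight_ge[OF G Y, where A = "\<lambda>y j. (\<lambda>xs. xs ! j) ` ?S y"])
    show nn: "(MAX xs\<in>?X. W xs y) \<ge> 0" if "y \<in> Y" for y
      using X(2) W0 le that by (meson ex_in_conv order_trans)
    fix xs assume xs: "xs \<in> ?X"
    \<comment> \<open>Only codewords with \<open>xs\<close> in their support contribute to the row
      sum.\<close>
    have "1 = (\<Sum>y\<in>{y\<in>Y. W xs y > 0}. W xs y)"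
      unfolding W1[OF xs, symmetric] using Y W0[OF xs]
      by (intro sum.mono_neutral_right) (auto simp: less_le)
    also have "\<dots> \<le> (\<Sum>y\<in>{y\<in>Y. W xs y > 0}. MAX xs\<in>?X. W xs y)"
      using le[OF xs] by (intro sum_mono)
    \<comment> \<open>A support is contained in its box; a box may contain \<open>xs\<close> without
      the support doing so, which only adds nonnegative weights.\<close>
    also have "\<dots> \<le> (\<Sum>y\<in>{y\<in>Y. \<forall>j<t. xs ! j \<in> (\<lambda>xs. xs ! j) ` ?S y}. MAX xs\<in>?X. W xs y)"
      using Y nn xs by (intro sum_mono2) auto
    finally show "1 \<le> (\<Sum>y\<in>{y\<in>Y. \<forall>j<t. xs ! j \<in> (\<lambda>xs. xs ! j) ` ?S y}. MAX xs\<in>?X. W xs y)" .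
  qed (use ind independent_set_or_powerD in blast)
qed

lemma max_leakage_valid:
  assumes "simple_graph G" "verts G \<noteq> {}" "valid_mapping G t Y W"
  shows "max_leakage c G t Y W = log c (\<Sum>y\<in>Y. MAX xs\<in>seqs (verts G) t. W xs y)"
  using max_leakage_eq(1)[of G t Y W c] assms by (simp add: valid_mapping_def)

section \<open>The one-letter mapping of a coloring and its products\<close>

lemma codewords_Sigma: "codewords P = (SIGMA T:set_mset P. {..<count P T})"
  by (auto simp: codewords_def intro: count_inI)

lemma finite_codewords: "finite (codewords P)"
  by (simp add: codewords_Sigma)

lemma card_codewords: "card (codewords P) = size P"
  by (simp add: codewords_Sigma size_multiset_overloaded_eq)

lemma card_codewords_filter: "card {y\<in>codewords P. Q (fst y)} = size {#T \<in># P. Q T#}"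
proof -
  have "{y\<in>codewords P. Q (fst y)} = codewords {#T \<in># P. Q T#}"
    by (auto simp: codewords_def split: if_splits)
  then show ?thesis by (simp add: card_codewords)
qed

text \<open>The letter lies in exactly \<open>b\<close> codewords, each of probability
  \<open>1 / b\<close>.\<close>

lemma sum_coloring_mapping:
  assumes "fold_coloring G b P" "b > 0" "xs ! 0 \<in> verts G"
  shows "(\<Sum>y\<in>codewords P. coloring_mapping b xs y) = 1"
proof -
  have "(\<Sum>y\<in>codewords P. coloring_mapping b xs y)
      = (\<Sum>y\<in>{y\<in>codewords P. xs ! 0 \<in> fst y}. 1 / real b)"
    unfolding coloring_mapping_def by (rule sum.inter_filter[symmetric, OF finite_codewords])
  also have "\<dots> = 1"
    using assms card_codewords_filter[of P "\<lambda>T. xs ! 0 \<in> T"] by (simp add: fold_coloring_def)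
  finally show ?thesis .
qed

lemma codeword_independent:
  "fold_coloring G b P \<Longrightarrow> y \<in> codewords P \<Longrightarrow> independent_set G (fst y)"
  by (auto simp: codewords_Sigma fold_coloring_def)

lemma valid_coloring_mapping:
  assumes P: "fold_coloring G b P" "b > 0"
  shows "valid_mapping G 1 (codewords P) (coloring_mapping b)"
  unfolding valid_mapping_def mapping_scheme_def verts_or_power
proof (intro conjI ballI)
  fix xs assume "xs \<in> seqs (verts G) 1"
  then have "xs ! 0 \<in> verts G" by (auto simp: seqs_def)
  then show "(\<Sum>y\<in>codewords P. coloring_mapping b xs y) = 1"
    by (rule sum_coloring_mapping[OF P])
next
  fix y assume y: "y \<in> codewords P"
  show "independent_set (or_power G 1) {xs \<in> seqs (verts G) 1. 0 < coloring_mapping b xs y}"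
    using codeword_independent[OF P(1) y]
    by (intro independent_set_or_powerI)
      (auto simp: coloring_mapping_def independent_set_def split: if_splits)
qed (auto simp: finite_codewords coloring_mapping_def)

text \<open>Each of the \<open>size P\<close> codewords contributes at most \<open>1 / b\<close>,
  and \<open>leakage_sum_ge\<close> at length 1 gives the reverse inequality, so no individual
  maximum has to be evaluated.\<close>

lemma max_leakage_coloring_mapping:
  assumes G: "simple_graph G" "verts G \<noteq> {}" and c: "c > 1"
    and P: "fold_coloring G b P" "b > 0"
    and opt: "fractional_chromatic_number G = real (size P) / real b"
  shows "max_leakage c G 1 (codewords P) (coloring_mapping b)
           = log c (fractional_chromatic_number G)"
proof -
  let ?S = "\<Sum>y\<in>codewords P. MAX xs\<in>seqs (verts G) 1. coloring_mapping b xs y"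
  note valid = valid_coloring_mapping[OF P]
  have "finite (seqs (verts G) 1)" "seqs (verts G) 1 \<noteq> {}"
    using G by (auto simp: simple_graph_def finite_seqs seqs_nonempty)
  then have "?S \<le> (\<Sum>y\<in>codewords P. 1 / real b)"
    by (intro sum_mono Max.boundedI) (auto simp: coloring_mapping_def)
  also have "\<dots> = fractional_chromatic_number G"
    by (simp add: card_codewords opt)
  finally have "?S = fractional_chromatic_number G"
    using leakage_sum_ge[OF G valid] by simp
  then show ?thesis using max_leakage_valid[OF G valid] by simp
qed

text \<open>Entries are encoded independently, and a codeword is a function from positions to
  one-letter codewords. The list \<open>[xs ! j]\<close> appears because
  \<open>coloring_mapping\<close> reads the head of a list.\<close>

definition product_mapping ::
    "nat \<Rightarrow> nat \<Rightarrow> 'a list \<Rightarrow> (nat \<Rightarrow> 'a set \<times> nat) \<Rightarrow> real" where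
  "product_mapping b t xs g = (\<Prod>j<t. coloring_mapping b [xs ! j] (g j))"

lemma product_mapping_nonneg: "product_mapping b t xs g \<ge> 0"
  by (auto simp: product_mapping_def coloring_mapping_def intro!: prod_nonneg)

lemma product_mapping_posD:
  assumes "product_mapping b t xs g > 0" "j < t"
  shows "xs ! j \<in> fst (g j)"
proof (rule ccontr)
  assume "xs ! j \<notin> fst (g j)"
  then have "product_mapping b t xs g = 0"
    using assms(2) by (auto simp: product_mapping_def coloring_mapping_def intro!: prod_zero)
  then show False using assms(1) by simp
qed

lemma product_mapping_le: "product_mapping b t xs g \<le> (1 / real b) ^ t"
proof -
  have "product_mapping b t xs g \<le> (\<Prod>j<t. 1 / real b)"
    unfolding product_mapping_def by (intro prod_mono) (auto simp: coloring_mapping_def)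
  then show ?thesis by simp
qed

lemma valid_product_mapping:
  assumes P: "fold_coloring G b P" "b > 0"
  shows "valid_mapping G t (PiE {..<t} (\<lambda>_. codewords P)) (product_mapping b t)"
  unfolding valid_mapping_def mapping_scheme_def verts_or_power
proof (intro conjI ballI)
  show "finite (PiE {..<t} (\<lambda>_. codewords P))" by (simp add: finite_PiE finite_codewords)
next
  fix xs assume xs: "xs \<in> seqs (verts G) t"
  \<comment> \<open>By distributivity the sum over codeword tuples factors into one-letter sums,
    each equal to 1.\<close>
  have "(\<Sum>g\<in>PiE {..<t} (\<lambda>_. codewords P). product_mapping b t xs g)
      = (\<Prod>j<t. \<Sum>y\<in>codewords P. coloring_mapping b [xs ! j] y)"
    unfolding product_mapping_def by (intro prod_sum_PiE[symmetric]) (auto simp: finite_codewords)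
  also have "\<dots> = 1"
  proof (intro prod.neutral ballI sum_coloring_mapping[OF P])
    fix j assume "j \<in> {..<t}"
    then show "[xs ! j] ! 0 \<in> verts G" using xs nth_mem[of j xs] by (auto simp: seqs_def)
  qed
  finally show "(\<Sum>g\<in>PiE {..<t} (\<lambda>_. codewords P). product_mapping b t xs g) = 1" .
next
  fix g assume g: "g \<in> PiE {..<t} (\<lambda>_. codewords P)"
  show "independent_set (or_power G t) {xs \<in> seqs (verts G) t. 0 < product_mapping b t xs g}"
  proof (rule independent_set_or_powerI)
    fix xs vs j
    assume *: "xs \<in> {xs \<in> seqs (verts G) t. 0 < product_mapping b t xs g}"
      "vs \<in> {xs \<in> seqs (verts G) t. 0 < product_mapping b t xs g}" "j < t"
    then have "independent_set G (fst (g j))"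
      using g codeword_independent[OF P(1)] by (auto simp: PiE_iff)
    then show "{xs ! j, vs ! j} \<notin> edges G"
      using *(1,2) product_mapping_posD[OF _ *(3)] unfolding independent_set_def by blast
  qed auto
qed (rule product_mapping_nonneg)

text \<open>There are \<open>size P ^ t\<close> codewords, each with maximum at most
  \<open>(1 / b) ^ t\<close>.\<close>

lemma product_mapping_leakage_sum_le:
  assumes G: "simple_graph G" "verts G \<noteq> {}"
  shows "(\<Sum>g\<in>PiE {..<t} (\<lambda>_. codewords P). MAX xs\<in>seqs (verts G) t. product_mapping b t xs g)
           \<le> (real (size P) / real b) ^ t"
proof -
  have "finite (seqs (verts G) t)" "seqs (verts G) t \<noteq> {}"
    using G by (auto simp: simple_graph_def finite_seqs seqs_nonempty)
  then have "(\<Sum>g\<in>PiE {..<t} (\<lambda>_. codewords P). MAX xs\<in>seqs (verts G) t. product_mapping b t xs g)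
      \<le> (\<Sum>g\<in>PiE {..<t} (\<lambda>_. codewords P). (1 / real b) ^ t)"
    by (intro sum_mono) (auto simp: product_mapping_le)
  also have "\<dots> = (real (size P) / real b) ^ t"
    by (simp add: card_PiE card_codewords power_divide)
  finally show ?thesis .
qed

section \<open>Optimal leakage and its rate\<close>

lemma valid_mapping_reindex:
  assumes W: "valid_mapping G t Y W" and h: "bij_betw h Y' Y"
  shows "valid_mapping G t Y' (\<lambda>xs y. W xs (h y))"
    and "(\<Sum>y\<in>Y'. MAX xs\<in>S. W xs (h y)) = (\<Sum>y\<in>Y. MAX xs\<in>S. W xs y)"
proof -
  have "(\<Sum>y\<in>Y'. W xs (h y)) = (\<Sum>y\<in>Y. W xs y)" for xs
    by (rule sum.reindex_bij_betw[OF h])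
  then show "valid_mapping G t Y' (\<lambda>xs y. W xs (h y))"
    using W bij_betw_apply[OF h] bij_betw_finite[OF h]
    by (auto simp: valid_mapping_def mapping_scheme_def)
  show "(\<Sum>y\<in>Y'. MAX xs\<in>S. W xs (h y)) = (\<Sum>y\<in>Y. MAX xs\<in>S. W xs y)"
    by (rule sum.reindex_bij_betw[OF h])
qed

text \<open>The lower bound for all valid mappings and the product mapping of an optimal coloring
  meet at the \<open>t\<close>-th power, so the infimum is a minimum.\<close>

lemma optimal_leakage_eq:
  assumes G: "simple_graph G" "verts G \<noteq> {}" and c: "c > 1"
  shows "optimal_leakage c G t = real t * log c (fractional_chromatic_number G)"
proof -
  let ?\<chi> = "fractional_chromatic_number G"
  have chi: "?\<chi> > 0" using fractional_chromatic_number_ge_1[OF G] by linarith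
  have log: "real t * log c ?\<chi> = log c (?\<chi> ^ t)" using chi by (simp add: log_nat_power)
  obtain b P where P: "b > 0" "fold_coloring G b P" "?\<chi> = real (size P) / real b"
    using fractional_chromatic_number_attained[OF G] by blast
  let ?Y = "PiE {..<t} (\<lambda>_. codewords P)"
  have valid: "valid_mapping G t ?Y (product_mapping b t)"
    using P by (intro valid_product_mapping)
  have "finite ?Y" by (simp add: finite_PiE finite_codewords)
  \<comment> \<open>Codewords are numbered because \<open>optimal_leakage\<close> ranges over
    alphabets of natural numbers.\<close>
  then obtain h where h: "bij_betw h {0..<card ?Y} ?Y"
    using ex_bij_betw_nat_finite by blast
  let ?W = "\<lambda>xs k. product_mapping b t xs (h k)"
  note valid' = valid_mapping_reindex(1)[OF valid h]
  \<comment> \<open>The upper estimate counts product codewords; the lower one is the bound for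
    arbitrary valid mappings.\<close>
  have "(\<Sum>k\<in>{0..<card ?Y}. MAX xs\<in>seqs (verts G) t. ?W xs k) = ?\<chi> ^ t"
    using product_mapping_leakage_sum_le[OF G, where t = t and P = P and b = b] leakage_sum_ge[OF G valid'] P(3)
      valid_mapping_reindex(2)[OF valid h, of "seqs (verts G) t"] by simp
  then have attained: "max_leakage c G t {0..<card ?Y} ?W = real t * log c ?\<chi>"
    unfolding max_leakage_valid[OF G valid'] log by simp
  have "real t * log c ?\<chi> \<le> max_leakage c G t Y W" if "valid_mapping G t Y W"
    for Y :: "nat set" and W
  proof -
    have "log c (?\<chi> ^ t) \<le> log c (\<Sum>y\<in>Y. MAX xs\<in>seqs (verts G) t. W xs y)"
      using c chi leakage_sum_ge[OF G that]
      by (meson log_mono zero_less_power)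
    then show ?thesis unfolding max_leakage_valid[OF G that] log .
  qed
  then show ?thesis
    unfolding optimal_leakage_def using attained valid'
    by (intro cInf_eq_minimum) (force, blast)
qed

lemma optimal_leakage_rate_tendsto:
  assumes "simple_graph G" "verts G \<noteq> {}" "c > 1"
  shows "(\<lambda>t. optimal_leakage c G t / real t) \<longlonglongrightarrow> log c (fractional_chromatic_number G)"
proof (rule tendsto_eventually)
  show "eventually (\<lambda>t. optimal_leakage c G t / real t = log c (fractional_chromatic_number G))
          sequentially"
    \<comment> \<open>At \<open>t = 0\<close> the quotient is 0 by convention, so equality is
      claimed only for positive \<open>t\<close>.\<close>
    using eventually_gt_at_top[of 0]
    by eventually_elim (simp add: optimal_leakage_eq[OF assms])
qed

theorem mainTheorem2:
  fixes \<Gamma> :: "'a ugraph" and c :: real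
  assumes "simple_graph \<Gamma>" and "verts \<Gamma> \<noteq> {}" and "c > 1"
  shows "(\<exists>b P. b > 0 \<and> fold_coloring \<Gamma> b P \<and>
            fractional_chromatic_number \<Gamma> = real (size P) / real b) \<and>
         (\<forall>b P. b > 0 \<and> fold_coloring \<Gamma> b P \<and>
            fractional_chromatic_number \<Gamma> = real (size P) / real b \<longrightarrow>
            valid_mapping \<Gamma> 1 (codewords P) (coloring_mapping b) \<and>
            max_leakage c \<Gamma> 1 (codewords P) (coloring_mapping b)
              = log c (fractional_chromatic_number \<Gamma>) \<and>
            convergent (\<lambda>t. optimal_leakage c \<Gamma> t / real t) \<and>
            max_leakage c \<Gamma> 1 (codewords P) (coloring_mapping b) = max_leakage_rate c \<Gamma>)"
proof (intro conjI allI impI)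
  show "\<exists>b P. b > 0 \<and> fold_coloring \<Gamma> b P \<and>
          fractional_chromatic_number \<Gamma> = real (size P) / real b"
    by (rule fractional_chromatic_number_attained) fact+
  note lim = optimal_leakage_rate_tendsto[OF assms]
  then show "convergent (\<lambda>t. optimal_leakage c \<Gamma> t / real t)"
    by (rule convergentI)
  fix b P
  assume P: "b > 0 \<and> fold_coloring \<Gamma> b P \<and>
    fractional_chromatic_number \<Gamma> = real (size P) / real b"
  then show "valid_mapping \<Gamma> 1 (codewords P) (coloring_mapping b)"
    by (intro valid_coloring_mapping) auto
  show leak: "max_leakage c \<Gamma> 1 (codewords P) (coloring_mapping b)
      = log c (fractional_chromatic_number \<Gamma>)"
    using P assms by (intro max_leakage_coloring_mapping) auto
  show "max_leakage c \<Gamma> 1 (codewords P) (coloring_mapping b) = max_leakage_rate c \<Gamma>"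
    unfolding leak max_leakage_rate_def using limI[OF lim] by simp
qed

end
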